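(* Let $n\ge 4$ be an integer and let $r\ge 2$ be even. Let $a_0,\dots,a_r\in\mathbb{C}$ be such that $a_1a_r\ne 0$ and $a_0a_r\notin\mathbb{R}$, and let $$\psi(z)=\frac{\sum_{k=0}^{r} a_{k} z^{k}}{\sum_{k=0}^{r} (-1)^{k}\,\overline{a_{r-k}}\, z^{k}},$$ where $\psi$ is assumed to be a rational map of degree $r$. Then $\phi(z)=z\,\psi(z^n)$ is a pseudo-real rational map with $\mathrm{Aut}(\phi)=\langle T(z)=\omega_n z\rangle\cong\mathbb{Z}_n$, where $\omega_n=e^{2\pi i/n}$.
   Context: $\mathrm{Aut}(\phi)=\{T\in\mathrm{PSL}_2(\mathbb{C}):T\circ\phi\circ T^{-1}=\phi\}$. An antiholomorphic automorphism of $\phi$ is a map $Q=T\circ J$, with $T\in\mathrm{PSL}_2(\mathbb{C})$ and $J(z)=\overline z$, such that $Q\circ\phi\circ Q^{-1}=\phi$. A reflection is an antiholomorphic involution of $\widehat{\mathbb{C}}$ with fixed points. A rational map is pseudo-real if it admits antiholomorphic automorphisms but none of them is a reflection. *)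

theory Defs
  imports
    Complex_Main
    "HOL-Computational_Algebra.Polynomial"
    "HOL-Algebra.Elementary_Groups"
begin

text \<open>The Riemann sphere is the type \<open>complex option\<close>, with \<open>None\<close> as the point at infinity.\<close>

type_synonym sphere = "complex option"

text \<open>
  The value at infinity is the ratio of the coefficients of index
  \<open>max (degree p) (degree q)\<close>. For coprime \<open>p\<close> and \<open>q\<close> there is no cancellation, so
  this is the map of the sphere given by \<open>p / q\<close>; the constant infinity is \<open>p = 1\<close>, \<open>q = 0\<close>.
\<close>

definition quotient_map :: "complex poly \<Rightarrow> complex poly \<Rightarrow> sphere \<Rightarrow> sphere" where
  "quotient_map p q z =
    (case z of
       Some w \<Rightarrow> if poly q w = 0 then None else Some (poly p w / poly q w)
     | None \<Rightarrow>
         (let d = max (degree p) (degree q)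
          in if coeff q d = 0 then None else Some (coeff p d / coeff q d)))"

definition rational_map_of_degree :: "nat \<Rightarrow> (sphere \<Rightarrow> sphere) \<Rightarrow> bool" where
  "rational_map_of_degree d f \<longleftrightarrow>
    (\<exists>p q. coprime p q \<and> max (degree p) (degree q) = d \<and> f = quotient_map p q)"

definition rational_map :: "(sphere \<Rightarrow> sphere) \<Rightarrow> bool" where
  "rational_map f \<longleftrightarrow> (\<exists>d. rational_map_of_degree d f)"

text \<open>The products of zero and infinity are left unspecified.\<close>

fun sphere_times :: "sphere \<Rightarrow> sphere \<Rightarrow> sphere" where
  "sphere_times (Some z) (Some w) = Some (z * w)"
| "sphere_times (Some z) None = (if z = 0 then undefined else None)"
| "sphere_times None (Some w) = (if w = 0 then undefined else None)"
| "sphere_times None None = None"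

definition moebius :: "complex \<Rightarrow> complex \<Rightarrow> complex \<Rightarrow> complex \<Rightarrow> sphere \<Rightarrow> sphere" where
  "moebius a b c d z =
    (case z of
       Some w \<Rightarrow> if c * w + d = 0 then None else Some ((a * w + b) / (c * w + d))
     | None \<Rightarrow> if c = 0 then None else Some (a / c))"

text \<open>
  The group \<open>PSL\<^sub>2(\<complex>)\<close> is identified with its faithful image among the bijections of the sphere.
\<close>

definition PSL2C :: "(sphere \<Rightarrow> sphere) monoid" where
  "PSL2C = \<lparr>carrier = {moebius a b c d |a b c d. a * d - b * c = 1}, mult = (\<circ>), one = id\<rparr>"

definition sphere_cnj :: "sphere \<Rightarrow> sphere" where
  "sphere_cnj = map_option cnj"

definition anti_moebius :: "(sphere \<Rightarrow> sphere) set" where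
  "anti_moebius = {T \<circ> sphere_cnj |T. T \<in> carrier PSL2C}"

text \<open>
  Inverse functions are written \<open>inv_into UNIV\<close> because HOL-Algebra uses \<open>inv\<close> for inverses in
  a group.
\<close>

definition Aut :: "(sphere \<Rightarrow> sphere) \<Rightarrow> (sphere \<Rightarrow> sphere) set" where
  "Aut \<phi> = {T \<in> carrier PSL2C. T \<circ> \<phi> \<circ> inv_into UNIV T = \<phi>}"

definition anti_Aut :: "(sphere \<Rightarrow> sphere) \<Rightarrow> (sphere \<Rightarrow> sphere) set" where
  "anti_Aut \<phi> = {Q \<in> anti_moebius. Q \<circ> \<phi> \<circ> inv_into UNIV Q = \<phi>}"

text \<open>
  The antiholomorphic homeomorphisms of the sphere are exactly the elements of \<open>anti_moebius\<close>.
\<close>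

definition reflection :: "(sphere \<Rightarrow> sphere) \<Rightarrow> bool" where
  "reflection Q \<longleftrightarrow> Q \<in> anti_moebius \<and> Q \<circ> Q = id \<and> (\<exists>z. Q z = z)"

definition pseudo_real :: "(sphere \<Rightarrow> sphere) \<Rightarrow> bool" where
  "pseudo_real \<phi> \<longleftrightarrow>
    rational_map \<phi> \<and> anti_Aut \<phi> \<noteq> {} \<and> (\<forall>Q \<in> anti_Aut \<phi>. \<not> reflection Q)"

end

theory Submission
  imports
    Defs
    "HOL-Algebra.Group_Action"
    "HOL-Computational_Algebra.Fundamental_Theorem_Algebra"
    "HOL-Computational_Algebra.Polynomial_Factorial"
    "HOL-Computational_Algebra.Field_as_Ring"
begin

text \<open>
  Write \<open>\<psi> = P / Q\<close>. The denominator is the reversed conjugate of the numerator with alternating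
  signs, so \<open>\<psi> (- 1 / cnj w) = 1 / cnj (\<psi> w)\<close>. Consequently, for \<open>\<zeta>\<^sup>n = -1\<close>, the antipode
  \<open>z \<mapsto> \<zeta> / cnj z\<close> commutes with \<open>\<phi>(z) = z \<psi>(z\<^sup>n)\<close>, and so do the dilations by the \<open>n\<close>-th roots of
  unity. The point is to show that there is nothing else.

  The points zero and infinity are fixed by \<open>\<phi>\<close>, with complex conjugate multipliers that
  are not real. An antiholomorphic automorphism that fixes zero would conjugate the multiplier
  there (\<open>anti_Aut_moves_0\<close>); composing with the antipode, no automorphism takes zero to
  infinity. Automorphisms permute the fixed points of \<open>\<phi>\<close>, of which there are finitely many
  but at least three, so the automorphism group is finite. A barycentre argument shows that an
  automorphism that fixes one of zero and infinity fixes the other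
  (\<open>Aut_fix_infinity_imp_fix_0\<close>), and since \<open>a\<^sub>0\<close> and \<open>a\<^sub>1\<close> do not vanish, it is then a dilation by an
  \<open>n\<close>-th root of unity (\<open>Aut_fix_0_imp_dilation\<close>).

  Hence zero and infinity lie in different orbits and have the same cyclic stabilizer of order
  \<open>n \<ge> 4\<close>. Every Moebius transformation except the identity has one or two fixed points, and counting
  these shows that the stabilizer is then the whole group
  (\<open>stabilizer_eq_carrier_if_few_fixed_points\<close>). Therefore the antiholomorphic automorphisms are
  the maps \<open>z \<mapsto> u / cnj z\<close> with \<open>u\<^sup>n = -1\<close>, and such a map has no fixed point since \<open>u\<close> is not
  a positive real number.
\<close>

section \<open>Finite group actions with few fixed points\<close>

text \<open>
  Counting the pairs of a group element and a point of the orbit that it fixes: this is Burnside's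
  lemma for a single orbit, where the ambient set may be infinite.
\<close>

lemma (in group_action) sum_card_invariants_orbit:
  assumes "finite (carrier G)" and "x \<in> E"
  shows "(\<Sum>g\<in>carrier G. card (invariants (orbit G \<phi> x) \<phi> g)) = order G"
proof -
  have fin: "finite (orbit G \<phi> x)"
    using assms(1) by (simp add: orbit_def)
  have "(\<Sum>g\<in>carrier G. card (invariants (orbit G \<phi> x) \<phi> g)) =
        (\<Sum>g\<in>carrier G. \<Sum>y\<in>orbit G \<phi> x. if \<phi> g y = y then 1 else 0)"
    using fin by (simp add: card_as_sums invariants_def)
  also have "\<dots> = (\<Sum>y\<in>orbit G \<phi> x. \<Sum>g\<in>carrier G. if \<phi> g y = y then 1 else 0)"
    by (rule sum.swap)
  also have "\<dots> = (\<Sum>y\<in>orbit G \<phi> x. card (stabilizer G \<phi> y))"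
    using assms(1) by (simp add: card_as_sums stabilizer_def)
  also have "\<dots> = order G"
    using assms by (intro card_stablizer_sum) (auto simp: orbits_def)
  finally show ?thesis .
qed

lemma (in group_action) orbits_disjoint:
  assumes "x \<in> E" "y \<in> E" "y \<notin> orbit G \<phi> x"
  shows "orbit G \<phi> x \<inter> orbit G \<phi> y = {}"
proof (rule ccontr)
  assume "\<not> ?thesis"
  then obtain z where z: "z \<in> orbit G \<phi> x" "z \<in> orbit G \<phi> y" by blast
  have "z \<in> E"
    using z(1) assms(1) element_image by (auto simp: orbit_def)
  then have "y \<in> orbit G \<phi> x"
    using z assms orbit_sym orbit_trans by meson
  then show False using assms(3) by simp
qed

text \<open>
  This replaces the classification of the finite subgroups of \<open>PSL\<^sub>2(\<complex>)\<close>. Let \<open>N\<close> be the group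
  order and \<open>m = N / s\<close> the length of the orbits of \<open>x\<close> and \<open>y\<close>, where \<open>s \<ge> 4\<close> is the order of their
  stabilizer. A third orbit on which some element other than the identity has a fixed point has
  length at most \<open>N / 2\<close>. As the identity fixes all points and no other element fixes more than
  two, counting fixed points on the three orbits would give
  \<open>3 N \<le> m + m + N / 2 + 2 (N - 1) \<le> 3 N - 2\<close>, which is absurd. So every element other than the
  identity fixes points of the first two orbits only; since the stabilizers of \<open>x\<close> and \<open>y\<close> agree, it
  fixes a point in each of them, and counting again gives \<open>2 N \<ge> 2 m + 2 (N - 1)\<close>, so \<open>m = 1\<close>.

  The bound \<open>4\<close> is sharp: the rotation group of the tetrahedron, with \<open>x\<close> and \<open>y\<close> a vertex and the
  centre of the opposite face, satisfies everything else with \<open>s = 3\<close>.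
\<close>

theorem (in group_action) stabilizer_eq_carrier_if_few_fixed_points:
  assumes fin: "finite (carrier G)"
    and x: "x \<in> E" and y: "y \<in> E" and xy: "y \<notin> orbit G \<phi> x"
    and stab: "stabilizer G \<phi> y = stabilizer G \<phi> x"
    and four: "card (stabilizer G \<phi> x) \<ge> 4"
    and fixed: "\<And>g. g \<in> carrier G \<Longrightarrow> g \<noteq> \<one> \<Longrightarrow>
        finite (invariants E \<phi> g) \<and> invariants E \<phi> g \<noteq> {} \<and> card (invariants E \<phi> g) \<le> 2"
  shows "stabilizer G \<phi> x = carrier G"
proof -
  interpret group G
    using group_hom group_hom.axioms(1) by auto
  let ?N = "order G" and ?O = "orbit G \<phi>" and ?F = "\<lambda>z g. invariants (orbit G \<phi> z) \<phi> g"
  have N: "?N \<ge> 1"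
    using fin by (simp add: order_gt_0_iff_finite Suc_leI)
  have finO: "finite (?O z)" for z
    using fin by (simp add: orbit_def)
  have OE: "?O z \<subseteq> E" if "z \<in> E" for z
    using that element_image by (auto simp: orbit_def)
  have memO: "z \<in> ?O z" if "z \<in> E" for z
    using that orbit_refl by simp
  have finF: "finite (?F z g)" for z g
    using finO by (simp add: invariants_def)
  define m where "m = card (?O x)"
  have mx: "m * card (stabilizer G \<phi> x) = ?N" and my: "card (?O y) = m"
    using orbit_stabilizer_theorem[OF x] orbit_stabilizer_theorem[OF y] stab four
    by (simp_all add: m_def) (metis mult_cancel2 not_numeral_le_zero)
  have disj: "?O x \<inter> ?O y = {}"
    using orbits_disjoint[OF x y xy] .
  have card1: "card (?F z \<one>) = card (?O z)" if "z \<in> E" for z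
  proof -
    have "?F z \<one> = ?O z"
      using OE[OF that] id_eq_one by (auto simp: invariants_def) (metis restrict_apply' subsetD)
    then show ?thesis by simp
  qed
  have split_one: "(\<Sum>g\<in>carrier G. f g) = f \<one> + (\<Sum>g\<in>carrier G - {\<one>}. f g)" for f :: "'a \<Rightarrow> nat"
    using fin by (simp add: sum.remove)
  have cardN: "card (carrier G - {\<one>}) = ?N - 1"
    by (simp add: order_def)
  have fixed_in: "\<exists>z \<in> invariants E \<phi> g. z \<in> ?O x \<union> ?O y"
    if g: "g \<in> carrier G" "g \<noteq> \<one>" for g
  proof (rule ccontr)
    assume no: "\<not> ?thesis"
    obtain p where p: "p \<in> invariants E \<phi> g" using fixed[OF g] by blast
    then have pE: "p \<in> E" and gp: "\<phi> g p = p" and pO: "p \<notin> ?O x" "p \<notin> ?O y"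
      using no by (auto simp: invariants_def)
    have disj': "?O x \<inter> ?O p = {}" "?O y \<inter> ?O p = {}"
      using orbits_disjoint x y pE pO by blast+
    have le2: "card (?F x h) + card (?F y h) + card (?F p h) \<le> 2"
      if h: "h \<in> carrier G - {\<one>}" for h
    proof -
      have "card (?F x h) + card (?F y h) + card (?F p h) = card (?F x h \<union> ?F y h \<union> ?F p h)"
        using disj disj' finF by (subst card_Un_disjoint, auto simp: invariants_def)+
      also have "\<dots> \<le> card (invariants E \<phi> h)"
        using fixed h OE x y pE by (intro card_mono) (auto simp: invariants_def)
      finally show ?thesis using fixed h by fastforce
    qed
    have "3 * ?N = (\<Sum>h\<in>carrier G. card (?F x h) + card (?F y h) + card (?F p h))"
      using sum_card_invariants_orbit[OF fin] x y pE by (simp add: sum.distrib)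
    also have "\<dots> \<le> 2 * m + card (?O p) + (\<Sum>h\<in>carrier G - {\<one>}. 2)"
      unfolding split_one using card1[OF x] card1[OF y] card1[OF pE] my
      by (intro add_mono sum_mono le2) (simp_all add: m_def)
    also have "\<dots> = 2 * m + card (?O p) + 2 * (?N - 1)"
      by (simp add: cardN)
    finally have main: "?N + 2 \<le> 2 * m + card (?O p)"
      using N by linarith
    have "{\<one>, g} \<subseteq> stabilizer G \<phi> p"
      using g gp pE id_eq_one by (auto simp: stabilizer_def) (metis restrict_apply')
    then have "2 \<le> card (stabilizer G \<phi> p)"
      using g fin by (metis card_2_iff card_mono rev_finite_subset stabilizer_subset)
    then have "card (?O p) * 2 \<le> ?N"
      using orbit_stabilizer_theorem[OF pE] by (metis mult_le_mono2)
    moreover have "m * 4 \<le> ?N"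
      using mx four by (metis mult_le_mono2)
    ultimately show False using main by linarith
  qed
  have eq2: "card (?F x g) + card (?F y g) \<ge> 2" if g: "g \<in> carrier G - {\<one>}" for g
  proof -
    obtain z where z: "\<phi> g z = z" "z \<in> ?O x \<union> ?O y"
      using fixed_in g by (auto simp: invariants_def)
    then obtain h w where h: "h \<in> carrier G" "w = x \<or> w = y" "z = \<phi> h w"
      by (auto simp: orbit_def)
    have wE: "w \<in> E" using h x y by auto
    \<comment> \<open>The conjugate of \<open>g\<close> by \<open>h\<close> fixes one of \<open>x\<close> and \<open>y\<close>, hence both, so \<open>g\<close> fixes the
      translates of both.\<close>
    define k where "k = inv h \<otimes> (g \<otimes> h)"
    have k: "k \<in> carrier G" using g h by (auto simp: k_def)
    have "\<phi> k w = w"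
      using g h wE z(1) orbit_sym_aux[OF h(1) wE] by (simp add: composition_rule k_def)
    then have "k \<in> stabilizer G \<phi> x" "k \<in> stabilizer G \<phi> y"
      using k h(2) stab by (auto simp: stabilizer_def)
    then have kf: "\<phi> k x = x" "\<phi> k y = y" by (auto simp: stabilizer_def)
    have gh: "g \<otimes> h = h \<otimes> k"
      using g h by (simp add: k_def m_assoc[symmetric])
    have fx: "\<phi> g (\<phi> h v) = \<phi> h v" if "v \<in> E" "\<phi> k v = v" for v
    proof -
      have "\<phi> g (\<phi> h v) = \<phi> (g \<otimes> h) v" using g h that by (simp add: composition_rule)
      also have "\<dots> = \<phi> h (\<phi> k v)" unfolding gh using h k that by (subst composition_rule) auto
      finally show ?thesis using that by simp
    qed
    have "\<phi> h x \<in> ?F x g" "\<phi> h y \<in> ?F y g"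
      using fx x y kf h by (auto simp: invariants_def orbit_def)
    then have "card (?F x g) \<ge> 1" "card (?F y g) \<ge> 1"
      using finF by (auto simp: Suc_le_eq card_gt_0_iff)
    then show ?thesis by simp
  qed
  have "2 * m + 2 * (?N - 1) = 2 * m + (\<Sum>g\<in>carrier G - {\<one>}. 2)"
    by (simp add: cardN)
  also have "\<dots> \<le> (\<Sum>g\<in>carrier G. card (?F x g) + card (?F y g))"
    unfolding split_one using card1[OF x] card1[OF y] my
    by (intro add_mono sum_mono eq2) (simp_all add: m_def)
  also have "\<dots> = 2 * ?N"
    using sum_card_invariants_orbit[OF fin] x y by (simp add: sum.distrib)
  finally have "m \<le> 1" using N by linarith
  then have "?N \<le> card (stabilizer G \<phi> x)"
    using mx N by (metis mult_le_mono1 mult_1)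
  then show ?thesis
    using fin stabilizer_subset by (metis card_subset_eq card_mono le_antisym order_def)
qed

section \<open>The group of Moebius transformations\<close>

lemma moebius_compose:
  assumes "a' * d' - b' * c' \<noteq> 0"
  shows "moebius a b c d \<circ> moebius a' b' c' d' =
    moebius (a * a' + b * c') (a * b' + b * d') (c * a' + d * c') (c * b' + d * d')"
proof
  have common: "x * (y / v) + t = (x * y + t * v) / v" if "v \<noteq> 0" for x y v t :: complex
    using that by (simp add: add_divide_distrib)
  fix z
  show "(moebius a b c d \<circ> moebius a' b' c' d') z =
    moebius (a * a' + b * c') (a * b' + b * d') (c * a' + d * c') (c * b' + d * d') z"
  proof (cases z)
    case None
    show ?thesis
    proof (cases "c' = 0")
      case True
      then show ?thesis using assms by (simp add: None moebius_def)
    next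
      case False
      have num: "c * (a' / c') + d = (c * a' + d * c') / c'"
        "a * (a' / c') + b = (a * a' + b * c') / c'" by (rule common[OF False])+
      have cancel: "x / c' = 0 \<longleftrightarrow> x = 0" "(y / c') / (x / c') = y / x" for x y
        using False by simp_all
      show ?thesis
        by (simp only: None moebius_def comp_apply option.case False if_False num cancel)
    qed
  next
    case (Some w)
    have 1: "a * (a' * w + b') + b * (c' * w + d') = (a * a' + b * c') * w + (a * b' + b * d')"
      "c * (a' * w + b') + d * (c' * w + d') = (c * a' + d * c') * w + (c * b' + d * d')"
      by (simp_all add: algebra_simps)
    show ?thesis
    proof (cases "c' * w + d' = 0")
      case True
      have "a' * w + b' \<noteq> 0"
      proof
        assume 0: "a' * w + b' = 0"
        have "a' * d' - b' * c' = a' * (c' * w + d') - c' * (a' * w + b')"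
          by (simp add: algebra_simps)
        then show False using 0 True assms by simp
      qed
      then show ?thesis using True by (simp add: Some moebius_def flip: 1)
    next
      case False
      have num: "c * ((a' * w + b') / (c' * w + d')) + d =
          ((c * a' + d * c') * w + (c * b' + d * d')) / (c' * w + d')"
        "a * ((a' * w + b') / (c' * w + d')) + b =
          ((a * a' + b * c') * w + (a * b' + b * d')) / (c' * w + d')"
        unfolding 1[symmetric] by (rule common[OF False])+
      have cancel: "x / (c' * w + d') = 0 \<longleftrightarrow> x = 0"
          "(y / (c' * w + d')) / (x / (c' * w + d')) = y / x" for x y
        using False by simp_all
      show ?thesis
        by (simp only: Some moebius_def comp_apply option.case False if_False num cancel)
    qed
  qed
qed

lemma moebius_scale: "t \<noteq> 0 \<Longrightarrow> moebius (t * a) (t * b) (t * c) (t * d) = moebius a b c d"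
proof
  fix z assume t: "t \<noteq> 0"
  have "t * c * w + t * d = t * (c * w + d)" "t * a * w + t * b = t * (a * w + b)" for w
    by (simp_all add: algebra_simps)
  then show "moebius (t * a) (t * b) (t * c) (t * d) z = moebius a b c d z"
    using t by (simp add: moebius_def split: option.split)
qed

lemma moebius_in_PSL2C:
  assumes "a * d - b * c \<noteq> 0"
  shows "moebius a b c d \<in> carrier PSL2C"
proof -
  define t where "t = 1 / csqrt (a * d - b * c)"
  have t: "t \<noteq> 0" using assms by (simp add: t_def)
  have "t * a * (t * d) - t * b * (t * c) = t\<^sup>2 * (a * d - b * c)"
    by (simp add: algebra_simps power2_eq_square)
  also have "\<dots> = 1" using assms by (simp add: t_def power_divide)
  finally show ?thesis
    using moebius_scale[OF t, of a b c d, symmetric] by (auto simp: PSL2C_def)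
qed

lemma PSL2C_cases:
  assumes "S \<in> carrier PSL2C"
  obtains a b c d where "S = moebius a b c d" "a * d - b * c = 1"
  using assms by (auto simp: PSL2C_def)

lemma moebius_id: "a \<noteq> 0 \<Longrightarrow> moebius a 0 0 a = id"
  by (auto simp: moebius_def split: option.split)

lemma PSL2C_simps [simp]: "x \<otimes>\<^bsub>PSL2C\<^esub> y = x \<circ> y" "\<one>\<^bsub>PSL2C\<^esub> = id"
  by (simp_all add: PSL2C_def)

lemma group_PSL2C: "group PSL2C"
proof (rule groupI)
  fix S assume "S \<in> carrier PSL2C"
  then obtain a b c d where S: "S = moebius a b c d" "a * d - b * c = 1" by (rule PSL2C_cases)
  have "moebius d (-b) (-c) a \<circ> S = id"
    using S(2) moebius_id[of 1] by (simp add: S(1) moebius_compose algebra_simps)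
  moreover have "moebius d (-b) (-c) a \<in> carrier PSL2C"
    using S(2) by (intro moebius_in_PSL2C) (simp add: algebra_simps)
  ultimately show "\<exists>R\<in>carrier PSL2C. R \<otimes>\<^bsub>PSL2C\<^esub> S = \<one>\<^bsub>PSL2C\<^esub>" by auto
next
  fix S R assume "S \<in> carrier PSL2C" "R \<in> carrier PSL2C"
  then obtain a b c d a' b' c' d' where S: "S = moebius a b c d" "a * d - b * c = 1"
    and R: "R = moebius a' b' c' d'" "a' * d' - b' * c' = 1"
    by (metis PSL2C_cases)
  have "(a * a' + b * c') * (c * b' + d * d') - (a * b' + b * d') * (c * a' + d * c')
      = (a * d - b * c) * (a' * d' - b' * c')" by (simp add: algebra_simps)
  then show "S \<otimes>\<^bsub>PSL2C\<^esub> R \<in> carrier PSL2C"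
    using S R by (auto simp: moebius_compose intro!: moebius_in_PSL2C)
qed (use moebius_in_PSL2C[of 1 1 0 0] moebius_id[of 1] in \<open>auto simp: comp_assoc\<close>)

interpretation PSL2C: group PSL2C
  by (rule group_PSL2C)

lemma PSL2C_bij: "S \<in> carrier PSL2C \<Longrightarrow> bij S"
  using PSL2C.l_inv PSL2C.r_inv by (metis PSL2C_simps o_bij)

lemma PSL2C_inv: "S \<in> carrier PSL2C \<Longrightarrow> (inv\<^bsub>PSL2C\<^esub> S) (S z) = z" "S \<in> carrier PSL2C \<Longrightarrow> S ((inv\<^bsub>PSL2C\<^esub> S) z) = z"
  using PSL2C.l_inv PSL2C.r_inv by (metis PSL2C_simps comp_apply id_apply)+

text \<open>
  Finite fixed points are the roots of \<open>c z\<^sup>2 + (d - a) z - b\<close>, and infinity is fixed exactly when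
  the degree drops, so that it takes the place of a lost root.
\<close>

lemma PSL2C_fixed_points:
  assumes "S \<in> carrier PSL2C" "S \<noteq> id"
  shows "finite {z. S z = z} \<and> {z. S z = z} \<noteq> {} \<and> card {z. S z = z} \<le> 2"
proof -
  obtain a b c d where S: "S = moebius a b c d" and det: "a * d - b * c = 1"
    using assms(1) by (rule PSL2C_cases)
  define p where "p = [:-b, d - a, c:]"
  define R where "R = {z. poly p z = 0}"
  have Some_fixed: "S (Some z) = Some z \<longleftrightarrow> z \<in> R" for z
  proof (cases "c * z + d = 0")
    case True
    have "a * z + b \<noteq> 0"
    proof
      assume "a * z + b = 0"
      moreover have "a * (c * z + d) - c * (a * z + b) = 1" using det by (simp add: algebra_simps)
      ultimately show False using True by simp
    qed
    moreover have "poly p z = z * (c * z + d) - (a * z + b)"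
      by (simp add: p_def algebra_simps)
    ultimately have "poly p z \<noteq> 0" using True by (metis diff_0 mult_zero_right neg_equal_0_iff_equal)
    then show ?thesis using True by (simp add: S moebius_def R_def)
  next
    case False
    then show ?thesis by (auto simp: S moebius_def R_def p_def field_simps)
  qed
  have None_fixed: "S None = None \<longleftrightarrow> c = 0" by (simp add: S moebius_def)
  have "p \<noteq> 0"
  proof
    assume "p = 0"
    then have abc: "b = 0" "c = 0" "d = a" by (auto simp: p_def)
    have "a \<noteq> 0" using det unfolding abc by auto
    then have "S = id" unfolding S abc by (rule moebius_id)
    then show False using assms(2) by contradiction
  qed
  then have R: "finite R" "card R \<le> degree p"
    unfolding R_def by (auto intro: poly_roots_finite card_poly_roots_bound)
  show ?thesis
  proof (cases "c = 0")
    case True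
    have "{z. S z = z} = insert None (Some ` R)"
    proof (rule Set.set_eqI)
      fix z show "z \<in> {z. S z = z} \<longleftrightarrow> z \<in> insert None (Some ` R)"
        using True Some_fixed None_fixed by (cases z) auto
    qed
    moreover have "card R \<le> 1" using R(2) True by (simp add: p_def split: if_splits)
    ultimately show ?thesis using R(1) by (simp add: card_insert_if card_image)
  next
    case False
    have "{z. S z = z} = Some ` R"
    proof (rule Set.set_eqI)
      fix z show "z \<in> {z. S z = z} \<longleftrightarrow> z \<in> Some ` R"
        using False Some_fixed None_fixed by (cases z) auto
    qed
    moreover have deg: "degree p = 2" using False by (simp add: p_def)
    moreover have "\<exists>z. poly p z = 0"
      using deg by (intro fundamental_theorem_of_algebra) (simp add: constant_degree)
    ultimately show ?thesis using R by (auto simp: card_image R_def)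
  qed
qed

subsection \<open>Antiholomorphic transformations\<close>

lemma sphere_cnj_simps [simp]: "sphere_cnj None = None" "sphere_cnj (Some z) = Some (cnj z)"
  by (simp_all add: sphere_cnj_def)

lemma sphere_cnj_comp: "sphere_cnj \<circ> sphere_cnj = id"
proof
  fix z show "(sphere_cnj \<circ> sphere_cnj) z = id z" by (cases z) auto
qed

lemma sphere_cnj_moebius:
  "sphere_cnj \<circ> moebius a b c d \<circ> sphere_cnj = moebius (cnj a) (cnj b) (cnj c) (cnj d)"
proof
  fix z
  have "c * cnj w + d = 0 \<longleftrightarrow> cnj c * w + cnj d = 0" for w
    by (metis complex_cnj_add complex_cnj_cnj complex_cnj_mult complex_cnj_zero)
  then show "(sphere_cnj \<circ> moebius a b c d \<circ> sphere_cnj) z = moebius (cnj a) (cnj b) (cnj c) (cnj d) z"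
    by (auto simp: moebius_def split: option.split)
qed

lemma cnj_PSL2C_cnj:
  assumes "S \<in> carrier PSL2C"
  shows "sphere_cnj \<circ> S \<circ> sphere_cnj \<in> carrier PSL2C"
proof -
  obtain a b c d where S: "S = moebius a b c d" and det: "a * d - b * c = 1"
    using assms by (rule PSL2C_cases)
  have "cnj a * cnj d - cnj b * cnj c = 1"
    using det by (metis complex_cnj_diff complex_cnj_mult complex_cnj_one)
  then show ?thesis unfolding S sphere_cnj_moebius by (intro moebius_in_PSL2C) simp
qed

lemma PSL2C_comp_anti_moebius:
  "S \<in> carrier PSL2C \<Longrightarrow> A \<in> anti_moebius \<Longrightarrow> S \<circ> A \<in> anti_moebius"
  unfolding anti_moebius_def using PSL2C.m_closed[of S] by (auto simp flip: comp_assoc)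

lemma anti_moebius_comp:
  assumes "A \<in> anti_moebius" "B \<in> anti_moebius"
  shows "A \<circ> B \<in> carrier PSL2C"
proof -
  obtain S T where "A = S \<circ> sphere_cnj" "B = T \<circ> sphere_cnj" "S \<in> carrier PSL2C" "T \<in> carrier PSL2C"
    using assms by (auto simp: anti_moebius_def)
  then show ?thesis
    using PSL2C.m_closed[OF _ cnj_PSL2C_cnj] by (simp add: comp_assoc)
qed

lemma anti_moebius_comp_PSL2C:
  assumes "A \<in> anti_moebius" "S \<in> carrier PSL2C"
  shows "A \<circ> S \<in> anti_moebius"
proof -
  obtain R where R: "A = R \<circ> sphere_cnj" "R \<in> carrier PSL2C"
    using assms(1) by (auto simp: anti_moebius_def)
  have "A \<circ> S = R \<circ> (sphere_cnj \<circ> S \<circ> sphere_cnj) \<circ> sphere_cnj"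
    using sphere_cnj_comp by (simp add: R(1) comp_assoc)
  moreover have "R \<circ> (sphere_cnj \<circ> S \<circ> sphere_cnj) \<in> carrier PSL2C"
    using PSL2C.m_closed[OF R(2) cnj_PSL2C_cnj[OF assms(2)]] by simp
  ultimately show ?thesis unfolding anti_moebius_def by blast
qed

lemma anti_moebius_bij: "A \<in> anti_moebius \<Longrightarrow> bij A"
  unfolding anti_moebius_def
  using PSL2C_bij o_bij[OF sphere_cnj_comp sphere_cnj_comp] by (auto intro: bij_comp)

subsection \<open>Automorphisms are the transformations that commute with the map\<close>

lemma conjugate_eq_iff_commute:
  assumes "bij S"
  shows "S \<circ> \<phi> \<circ> inv_into UNIV S = \<phi> \<longleftrightarrow> S \<circ> \<phi> = \<phi> \<circ> S"
proof
  assume "S \<circ> \<phi> \<circ> inv_into UNIV S = \<phi>"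
  then have "S \<circ> \<phi> \<circ> (inv_into UNIV S \<circ> S) = \<phi> \<circ> S" by (simp flip: comp_assoc)
  then show "S \<circ> \<phi> = \<phi> \<circ> S" using assms by (simp add: inv_o_cancel bij_is_inj)
next
  assume "S \<circ> \<phi> = \<phi> \<circ> S"
  then have "S \<circ> \<phi> \<circ> inv_into UNIV S = \<phi> \<circ> (S \<circ> inv_into UNIV S)" by (simp add: comp_assoc)
  then show "S \<circ> \<phi> \<circ> inv_into UNIV S = \<phi>" using surj_iff[THEN iffD1, OF bij_is_surj[OF assms]] by simp
qed

lemma Aut_iff: "S \<in> Aut \<phi> \<longleftrightarrow> S \<in> carrier PSL2C \<and> (\<forall>z. S (\<phi> z) = \<phi> (S z))"
  using conjugate_eq_iff_commute[of S \<phi>] PSL2C_bij by (auto simp: Aut_def fun_eq_iff)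

lemma anti_Aut_iff: "A \<in> anti_Aut \<phi> \<longleftrightarrow> A \<in> anti_moebius \<and> (\<forall>z. A (\<phi> z) = \<phi> (A z))"
  using conjugate_eq_iff_commute[of A \<phi>] anti_moebius_bij by (auto simp: anti_Aut_def fun_eq_iff)

lemma Aut_comp_anti_Aut: "S \<in> Aut \<phi> \<Longrightarrow> A \<in> anti_Aut \<phi> \<Longrightarrow> S \<circ> A \<in> anti_Aut \<phi>"
  by (simp add: Aut_iff anti_Aut_iff PSL2C_comp_anti_moebius)

lemma anti_Aut_comp_Aut: "A \<in> anti_Aut \<phi> \<Longrightarrow> S \<in> Aut \<phi> \<Longrightarrow> A \<circ> S \<in> anti_Aut \<phi>"
  by (simp add: Aut_iff anti_Aut_iff anti_moebius_comp_PSL2C)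

lemma anti_Aut_comp: "A \<in> anti_Aut \<phi> \<Longrightarrow> B \<in> anti_Aut \<phi> \<Longrightarrow> A \<circ> B \<in> Aut \<phi>"
  by (simp add: Aut_iff anti_Aut_iff anti_moebius_comp)

lemma subgroup_Aut: "subgroup (Aut \<phi>) PSL2C"
proof (rule PSL2C.subgroupI)
  show "Aut \<phi> \<subseteq> carrier PSL2C" by (auto simp: Aut_iff)
  have "id \<in> Aut \<phi>" using PSL2C.one_closed by (simp add: Aut_iff)
  then show "Aut \<phi> \<noteq> {}" by blast
  fix S R assume S: "S \<in> Aut \<phi>"
  show "inv\<^bsub>PSL2C\<^esub> S \<in> Aut \<phi>"
    using S by (auto simp: Aut_iff) (metis PSL2C_inv)
  assume "R \<in> Aut \<phi>"
  then show "S \<otimes>\<^bsub>PSL2C\<^esub> R \<in> Aut \<phi>"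
    using S PSL2C.m_closed by (auto simp: Aut_iff)
qed

lemma group_action_Aut: "group_action (PSL2C\<lparr>carrier := Aut \<phi>\<rparr>) UNIV (\<lambda>S. S)"
proof -
  have "(\<lambda>S. S) \<in> hom (PSL2C\<lparr>carrier := Aut \<phi>\<rparr>) (BijGroup UNIV)"
    using PSL2C_bij by (auto simp: hom_def BijGroup_def Bij_def Aut_iff compose_def fun_eq_iff)
  then show ?thesis
    using subgroup.subgroup_is_group[OF subgroup_Aut group_PSL2C] group_BijGroup
    by (simp add: group_action_def group_hom_def group_hom_axioms_def)
qed

text \<open>
  Automorphisms permute the fixed points of the map, and one that fixes three points is the identity.
  Hence the action on the set of fixed points is faithful.
\<close>

lemma finite_Aut:
  assumes "finite {z. \<phi> z = z}" and "card {z. \<phi> z = z} \<ge> 3"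
  shows "finite (Aut \<phi>)"
proof -
  let ?F = "{z. \<phi> z = z}"
  have "inj_on (\<lambda>S. restrict S ?F) (Aut \<phi>)"
  proof (rule inj_onI)
    fix S R assume SR: "S \<in> Aut \<phi>" "R \<in> Aut \<phi>" "restrict S ?F = restrict R ?F"
    then have mem: "S \<in> carrier PSL2C" "R \<in> carrier PSL2C" by (auto simp: Aut_iff)
    let ?K = "(inv\<^bsub>PSL2C\<^esub> R) \<circ> S"
    have K: "?K \<in> carrier PSL2C"
      using mem PSL2C.m_closed[of "inv\<^bsub>PSL2C\<^esub> R" S] by simp
    have sub: "?F \<subseteq> {z. ?K z = z}"
      using SR(3) PSL2C_inv(1)[OF mem(2)] by (auto simp: fun_eq_iff restrict_def) metis
    have "?K = id"
    proof (rule ccontr)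
      assume "?K \<noteq> id"
      from PSL2C_fixed_points[OF K this] have "finite {z. ?K z = z}" "card {z. ?K z = z} \<le> 2" by blast+
      then have "card ?F \<le> 2" using card_mono[OF _ sub] by linarith
      then show False using assms(2) by simp
    qed
    then have "R \<circ> ?K = R" by simp
    then show "S = R" using PSL2C_inv(2)[OF mem(2)] by (simp add: fun_eq_iff)
  qed
  moreover have "(\<lambda>S. restrict S ?F) ` Aut \<phi> \<subseteq> ?F \<rightarrow>\<^sub>E ?F"
  proof (intro image_subsetI)
    fix S assume "S \<in> Aut \<phi>"
    then have comm: "S (\<phi> z) = \<phi> (S z)" for z by (simp add: Aut_iff)
    have "\<phi> (S z) = S z" if "\<phi> z = z" for z
      using comm[of z] that by simp
    then show "restrict S ?F \<in> ?F \<rightarrow>\<^sub>E ?F" by simp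
  qed
  moreover have "finite (?F \<rightarrow>\<^sub>E ?F)"
    using assms(1) by (intro finite_PiE) auto
  ultimately show ?thesis using finite_imageD[OF finite_subset] by auto
qed

section \<open>Dilations and roots of unity\<close>

definition dilation :: "complex \<Rightarrow> sphere \<Rightarrow> sphere" where
  "dilation c = map_option (\<lambda>w. c * w)"

lemma dilation_simps [simp]: "dilation c None = None" "dilation c (Some w) = Some (c * w)"
  by (simp_all add: dilation_def)

lemma dilation_comp: "dilation c \<circ> dilation d = dilation (c * d)"
  by (simp add: fun_eq_iff dilation_def option.map_comp comp_def mult.assoc)

lemma dilation_1: "dilation 1 = id"
  by (simp add: dilation_def fun_eq_iff option.map_ident)

lemma inj_dilation: "inj dilation"
proof (rule injI)
  fix c d assume "dilation c = dilation d"
  then have "dilation c (Some 1) = dilation d (Some 1)" by simp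
  then show "c = d" by simp
qed

lemma dilation_in_PSL2C: "c \<noteq> 0 \<Longrightarrow> dilation c \<in> carrier PSL2C"
proof -
  assume c: "c \<noteq> 0"
  have "dilation c = moebius c 0 0 1"
    by (simp add: fun_eq_iff moebius_def dilation_def split: option.split)
  then show ?thesis using c moebius_in_PSL2C[of c 1 0 0] by simp
qed

lemma roots_of_unity_eq_powers:
  assumes "n > 0"
  shows "bij_betw (\<lambda>k. exp (2 * of_real pi * \<i> / of_nat n) ^ k) {..<n} {c :: complex. c ^ n = 1}"
proof -
  have "exp (2 * of_real pi * \<i> / of_nat n) ^ k = cis (2 * pi * real k / real n)" for k
    by (simp add: cis_conv_exp exp_of_nat_mult[symmetric] field_simps)
  then show ?thesis using bij_betw_roots_unity[OF assms] by simp
qed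

lemma dilations_generated:
  assumes "n > 0"
  shows "generate PSL2C {dilation (exp (2 * of_real pi * \<i> / of_nat n))} = dilation ` {c. c ^ n = 1}"
    (is "generate PSL2C {dilation ?\<omega>} = ?D")
proof
  have wn: "?\<omega> ^ n = 1"
    using assms by (simp add: exp_of_nat_mult[symmetric])
  have "subgroup ?D PSL2C"
  proof (rule PSL2C.subgroupI)
    show "?D \<subseteq> carrier PSL2C"
      using assms by (auto intro!: dilation_in_PSL2C simp: zero_power)
    show "?D \<noteq> {}" by (auto intro: exI[of _ 1])
    fix S R assume "S \<in> ?D"
    then obtain c where c: "S = dilation c" "c ^ n = 1" by auto
    then have c0: "c \<noteq> 0" using assms by (auto simp: zero_power)
    have "inv\<^bsub>PSL2C\<^esub> S = dilation (1 / c)"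
      using c0 by (intro PSL2C.inv_equality)
        (auto simp: c dilation_comp dilation_1 intro!: dilation_in_PSL2C)
    then show "inv\<^bsub>PSL2C\<^esub> S \<in> ?D"
      using c(2) by (auto simp: power_divide)
    assume "R \<in> ?D"
    then show "S \<otimes>\<^bsub>PSL2C\<^esub> R \<in> ?D"
      using c by (auto simp: dilation_comp power_mult_distrib)
  qed
  then show "generate PSL2C {dilation ?\<omega>} \<subseteq> ?D"
    using wn by (intro PSL2C.generate_subgroup_incl) auto
  have "dilation (?\<omega> ^ k) \<in> generate PSL2C {dilation ?\<omega>}" for k
  proof (induction k)
    case 0
    then show ?case using generate.one[of PSL2C] by (simp only: power_0 dilation_1 PSL2C_simps)
  next
    case (Suc k)
    then show ?case
      using generate.eng[OF generate.incl[of "dilation ?\<omega>"] Suc] by (simp add: dilation_comp)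
  qed
  moreover have "{c :: complex. c ^ n = 1} = (\<lambda>k. ?\<omega> ^ k) ` {..<n}"
    using roots_of_unity_eq_powers[OF assms] by (simp add: bij_betw_def)
  ultimately show "?D \<subseteq> generate PSL2C {dilation ?\<omega>}"
    by (simp add: image_subset_iff)
qed

lemma dilations_iso_integer_mod_group:
  assumes "n > 0"
  shows "PSL2C\<lparr>carrier := dilation ` {c. c ^ n = 1}\<rparr> \<cong> integer_mod_group n"
proof -
  let ?\<omega> = "exp (2 * of_real pi * \<i> / of_nat n) :: complex"
  let ?G = "PSL2C\<lparr>carrier := dilation ` {c. c ^ n = 1}\<rparr>"
  have wn: "?\<omega> ^ n = 1"
    using assms by (simp add: exp_of_nat_mult[symmetric])
  have wmod: "?\<omega> ^ (k mod n) = ?\<omega> ^ k" for k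
  proof -
    have "?\<omega> ^ k = ?\<omega> ^ (n * (k div n) + k mod n)" by simp
    then show ?thesis by (simp only: power_add power_mult wn power_one mult_1)
  qed
  let ?f = "\<lambda>k::int. dilation (?\<omega> ^ nat k)"
  have "bij_betw nat {0..<int n} {..<n}"
    by (rule bij_betwI[of _ _ _ int]) auto
  then have "bij_betw (dilation \<circ> ((\<lambda>k. ?\<omega> ^ k) \<circ> nat)) {0..<int n} (dilation ` {c. c ^ n = 1})"
    by (intro bij_betw_trans[OF bij_betw_trans[OF _ roots_of_unity_eq_powers[OF assms]]])
      (auto intro: inj_on_imp_bij_betw inj_on_subset[OF inj_dilation])
  then have bij: "bij_betw ?f (carrier (integer_mod_group n)) (carrier ?G)"
    using assms by (simp add: carrier_integer_mod_group comp_def)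
  have "?f \<in> hom (integer_mod_group n) ?G"
  proof (rule homI)
    fix x y assume "x \<in> carrier (integer_mod_group n)" "y \<in> carrier (integer_mod_group n)"
    then have "nat ((x + y) mod int n) = (nat x + nat y) mod n"
      using assms by (simp add: carrier_integer_mod_group nat_mod_distrib nat_add_distrib)
    then show "?f (x \<otimes>\<^bsub>integer_mod_group n\<^esub> y) = ?f x \<otimes>\<^bsub>?G\<^esub> ?f y"
      by (simp add: wmod dilation_comp power_add)
  qed (use bij in \<open>auto simp: bij_betw_def\<close>)
  then have "integer_mod_group n \<cong> ?G"
    using bij by (auto simp: is_iso_def iso_def)
  then show ?thesis
    by (rule group.iso_sym[OF group_integer_mod_group])
qed

section \<open>Rational maps of the sphere\<close>

lemma coprime_if_no_common_root:
  fixes p q :: "complex poly"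
  assumes "q \<noteq> 0" and "\<And>z. poly p z = 0 \<Longrightarrow> poly q z \<noteq> 0"
  shows "coprime p q"
proof (rule coprimeI)
  fix d assume d: "d dvd p" "d dvd q"
  then have "\<not> poly d z = 0" for z
    using assms(2)[of z] by (auto elim!: dvdE)
  then have "constant (poly d)" using fundamental_theorem_of_algebra by blast
  then have "degree d = 0" by (simp add: constant_degree)
  moreover have "d \<noteq> 0" using d assms(1) by auto
  ultimately show "is_unit d" by (simp add: is_unit_iff_degree)
qed

lemma quotient_map_smult: "t \<noteq> 0 \<Longrightarrow> quotient_map (smult t p) (smult t q) = quotient_map p q"
  by (simp add: fun_eq_iff quotient_map_def Let_def split: option.split)

text \<open>
  The values at all but finitely many points determine a rational map and, by comparison of
  degrees, the numerator and the denominator up to a common scalar.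
\<close>

lemma quotient_map_unique:
  assumes pq: "coprime p q" "max (degree p) (degree q) = r"
    and PQ: "degree P \<le> r" "degree Q = r" "Q \<noteq> 0"
    and eq: "\<And>z. poly Q z \<noteq> 0 \<Longrightarrow> quotient_map p q (Some z) = Some (poly P z / poly Q z)"
  shows "coprime P Q \<and> quotient_map p q = quotient_map P Q"
proof -
  have "(p * Q - q * P) * Q = 0"
  proof -
    have "poly ((p * Q - q * P) * Q) z = 0" for z
    proof (cases "poly Q z = 0")
      case False
      then have "poly q z \<noteq> 0" "poly p z / poly q z = poly P z / poly Q z"
        using eq[OF False] by (auto simp: quotient_map_def split: if_splits)
      then show ?thesis using False by (simp add: field_simps)
    qed simp
    then show ?thesis using poly_all_0_iff_0 by blast
  qed
  then have cross: "p * Q = q * P" using PQ(3) by simp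
  then have "q dvd p * Q" by simp
  then have "q dvd Q" using coprime_dvd_mult_right_iff[of q p Q] pq(1) by (simp add: coprime_commute)
  then obtain s where s: "Q = q * s" ..
  have q: "q \<noteq> 0" and s0: "s \<noteq> 0" using s PQ(3) by auto
  have P: "P = p * s" using cross q by (simp add: s algebra_simps)
  have "degree s = 0"
  proof (cases "degree q = r")
    case True
    then show ?thesis using PQ(2) q s0 by (simp add: s degree_mult_eq)
  next
    case False
    then have "degree p = r" "degree p \<noteq> 0" using pq(2) by auto
    moreover from this have "p \<noteq> 0" by auto
    ultimately show ?thesis using PQ(1) s0 degree_mult_eq[of p s] by (simp add: P)
  qed
  then obtain t where t: "s = [:t:]" by (rule degree_eq_zeroE)
  then have scaled: "t \<noteq> 0" "P = smult t p" "Q = smult t q" using s0 s P by auto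
  have "coprime P Q"
  proof (rule coprime_if_no_common_root[OF PQ(3)])
    fix z assume "poly P z = 0"
    then show "poly Q z \<noteq> 0" using scaled coprime_poly_0[OF pq(1), of z] by simp
  qed
  then show ?thesis using scaled quotient_map_smult[of t p q] by simp
qed

section \<open>The map and its antipodal symmetry\<close>

text \<open>
  The map \<open>z \<mapsto> z \<psi>(z\<^sup>n)\<close> for \<open>\<psi> = P / Q\<close>.
\<close>

definition spun_map :: "nat \<Rightarrow> complex poly \<Rightarrow> complex poly \<Rightarrow> sphere \<Rightarrow> sphere" where
  "spun_map n P Q = quotient_map (monom 1 1 * (P \<circ>\<^sub>p monom 1 n)) (Q \<circ>\<^sub>p monom 1 n)"

text \<open>
  The coefficient condition says that \<open>Q(w) = w\<^sup>r cnj (P (- 1 / cnj w))\<close>, so that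
  \<open>\<psi> = P / Q\<close> satisfies \<open>\<psi> (- 1 / cnj w) = 1 / cnj (\<psi> w)\<close>. The value \<open>\<psi> 0 = coeff P 0 / cnj (coeff P r)\<close>
  is the multiplier at the fixed point zero, and it differs from \<open>coeff P 0 * coeff P r\<close> by a
  positive real factor; hence \<open>nonreal\<close> says that this multiplier is not real.
\<close>

locale antipodal_pair =
  fixes n r :: nat and P Q :: "complex poly"
  assumes n4: "n \<ge> 4" and r_pos: "r > 0" and r_even: "even r"
    and degP: "degree P \<le> r" and degQ: "degree Q \<le> r"
    and cop: "coprime P Q"
    and coeff_Q: "\<And>k. k \<le> r \<Longrightarrow> coeff Q k = (-1) ^ k * cnj (coeff P (r - k))"
    and nonreal: "coeff P 0 * coeff P r \<notin> \<real>"
    and linear: "coeff P 1 \<noteq> 0"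
begin

abbreviation \<phi> :: "sphere \<Rightarrow> sphere" where "\<phi> \<equiv> spun_map n P Q"

lemma n_pos: "n > 0" using n4 by simp

lemma P0: "coeff P 0 \<noteq> 0" and Pr: "coeff P r \<noteq> 0"
  using nonreal by auto

lemma Q0: "coeff Q 0 = cnj (coeff P r)" and Qr: "coeff Q r = cnj (coeff P 0)"
  using coeff_Q[of 0] coeff_Q[of r] r_even by auto

lemma degree_eq: "degree P = r" "degree Q = r"
  using Pr P0 Qr degP degQ le_degree[of P r] le_degree[of Q r] by auto

lemma no_common_root: "poly P w = 0 \<Longrightarrow> poly Q w \<noteq> 0"
  using coprime_poly_0[OF cop] by blast

lemma poly_Q_antipode:
  assumes "w \<noteq> 0"
  shows "poly Q (- 1 / cnj w) = cnj (poly P w) / cnj w ^ r"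
proof -
  have "poly Q (- 1 / cnj w) = (\<Sum>k\<le>r. coeff Q k * (- 1 / cnj w) ^ k)"
    by (simp add: poly_altdef degree_eq)
  also have "\<dots> = (\<Sum>k\<le>r. cnj (coeff P (r - k)) / cnj w ^ k)"
  proof (rule sum.cong)
    fix k assume "k \<in> {..r}"
    then have "coeff Q k * (- 1 / cnj w) ^ k = cnj (coeff P (r - k)) * ((- 1) ^ k * (- 1 / cnj w) ^ k)"
      by (simp add: coeff_Q)
    also have "(- 1) ^ k * (- 1 / cnj w) ^ k = 1 / cnj w ^ k"
      by (simp add: power_mult_distrib[symmetric] power_divide)
    finally show "coeff Q k * (- 1 / cnj w) ^ k = cnj (coeff P (r - k)) / cnj w ^ k"
      by simp
  qed simp
  also have "\<dots> = (\<Sum>k\<le>r. cnj (coeff P k) / cnj w ^ (r - k))"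
    by (rule sum.reindex_bij_witness[of _ "\<lambda>k. r - k" "\<lambda>k. r - k"]) auto
  also have "\<dots> = (\<Sum>k\<le>r. cnj (coeff P k * w ^ k) / cnj w ^ r)"
  proof (rule sum.cong)
    fix k assume "k \<in> {..r}"
    then have "cnj w ^ r = cnj w ^ k * cnj w ^ (r - k)" by (simp flip: power_add)
    then show "cnj (coeff P k) / cnj w ^ (r - k) = cnj (coeff P k * w ^ k) / cnj w ^ r"
      using assms by simp
  qed simp
  also have "\<dots> = cnj (poly P w) / cnj w ^ r"
    by (simp add: poly_altdef degree_eq sum_divide_distrib)
  finally show ?thesis .
qed

lemma poly_P_antipode:
  assumes "w \<noteq> 0"
  shows "poly P (- 1 / cnj w) = cnj (poly Q w) / cnj w ^ r"
proof -
  have "poly Q w = poly Q (- 1 / cnj (- 1 / cnj w))" using assms by simp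
  also have "\<dots> = cnj (poly P (- 1 / cnj w)) * w ^ r"
    using assms r_even by (subst poly_Q_antipode) (auto simp: power_divide)
  finally show ?thesis using assms by simp
qed

lemma degrees_spun_map:
  "degree (monom 1 1 * (P \<circ>\<^sub>p monom 1 n)) = Suc (r * n)" "degree (Q \<circ>\<^sub>p monom 1 n) = r * n"
proof -
  have "P \<circ>\<^sub>p monom 1 n \<noteq> 0"
    using P0 n_pos by (auto dest!: arg_cong[of _ _ "\<lambda>p. poly p 0"]
      simp: poly_pcompose poly_monom poly_0_coeff_0 zero_power)
  then show "degree (monom 1 1 * (P \<circ>\<^sub>p monom 1 n)) = Suc (r * n)"
    by (simp add: degree_mult_eq degree_monom_eq degree_pcompose degree_eq)
qed (simp add: degree_monom_eq degree_pcompose degree_eq)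

lemma \<phi>_None [simp]: "\<phi> None = None"
proof -
  have "coeff (Q \<circ>\<^sub>p monom 1 n) (Suc (r * n)) = 0"
    by (rule coeff_eq_0) (simp add: degrees_spun_map)
  then show ?thesis unfolding spun_map_def quotient_map_def degrees_spun_map by simp
qed

lemma \<phi>_Some:
  "\<phi> (Some z) = (if poly Q (z ^ n) = 0 then None else Some (z * (poly P (z ^ n) / poly Q (z ^ n))))"
  by (simp add: spun_map_def quotient_map_def poly_pcompose poly_monom)

lemma \<phi>_0 [simp]: "\<phi> (Some 0) = Some 0"
  using n_pos Pr by (simp add: \<phi>_Some zero_power poly_0_coeff_0 Q0)

lemma rational_map_\<phi>: "rational_map \<phi>"
proof -
  have "coprime (monom 1 1 * (P \<circ>\<^sub>p monom 1 n)) (Q \<circ>\<^sub>p monom 1 n)"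
  proof (rule coprime_if_no_common_root)
    show "Q \<circ>\<^sub>p monom 1 n \<noteq> 0"
      using Pr n_pos by (auto dest!: arg_cong[of _ _ "\<lambda>p. poly p 0"]
        simp: poly_pcompose poly_monom poly_0_coeff_0 zero_power Q0)
    fix z assume "poly (monom 1 1 * (P \<circ>\<^sub>p monom 1 n)) z = 0"
    then have "z = 0 \<or> poly P (z ^ n) = 0" by (simp add: poly_pcompose poly_monom)
    then show "poly (Q \<circ>\<^sub>p monom 1 n) z \<noteq> 0"
      using no_common_root Pr n_pos
      by (auto simp: poly_pcompose poly_monom zero_power poly_0_coeff_0 Q0)
  qed
  then show ?thesis
    unfolding rational_map_def rational_map_of_degree_def spun_map_def by blast
qed

text \<open>
  For an \<open>n\<close>-th root \<open>\<zeta>\<close> of \<open>-1\<close>, the map \<open>z \<mapsto> \<zeta> / cnj z\<close> lifts the antipodal map of \<open>w = z\<^sup>n\<close>. Swapping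
  zero and infinity, it makes up for the inversion of \<open>\<psi>\<close> and so commutes with \<open>z \<psi>(z\<^sup>n)\<close>.
\<close>

definition \<zeta> :: complex where "\<zeta> = cis (pi / real n)"

lemma \<zeta>_power: "\<zeta> ^ n = -1" and \<zeta>_nz: "\<zeta> \<noteq> 0"
  using n_pos by (simp_all add: \<zeta>_def DeMoivre)

definition antipode :: "sphere \<Rightarrow> sphere" where
  "antipode = moebius 0 \<zeta> 1 0 \<circ> sphere_cnj"

lemma antipode_simps [simp]:
  "antipode None = Some 0" "antipode (Some 0) = None"
  "z \<noteq> 0 \<Longrightarrow> antipode (Some z) = Some (\<zeta> / cnj z)"
  by (simp_all add: antipode_def moebius_def)

lemma antipode_in_anti_Aut: "antipode \<in> anti_Aut \<phi>"
proof -
  have "antipode \<in> anti_moebius"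
    unfolding anti_moebius_def antipode_def using moebius_in_PSL2C[of 0 0 \<zeta> 1] \<zeta>_nz by auto
  moreover have "antipode (\<phi> z) = \<phi> (antipode z)" for z
  proof (cases "z = None \<or> z = Some 0")
    case True
    then show ?thesis by auto
  next
    case False
    then obtain x where z: "z = Some x" and x: "x \<noteq> 0" by (cases z) auto
    let ?w = "x ^ n"
    have w: "?w \<noteq> 0" using x by simp
    define v where "v = - 1 / cnj ?w"
    have pow: "(\<zeta> / cnj x) ^ n = v"
      by (simp add: v_def power_divide \<zeta>_power)
    have anti: "poly P v = cnj (poly Q ?w) / cnj ?w ^ r" "poly Q v = cnj (poly P ?w) / cnj ?w ^ r"
      unfolding v_def using poly_P_antipode[OF w] poly_Q_antipode[OF w] by blast+
    have rhs: "\<phi> (antipode z) = (if poly P ?w = 0 then None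
        else Some (\<zeta> / cnj x * (cnj (poly Q ?w) / cnj (poly P ?w))))"
      using w x by (simp add: z \<phi>_Some pow anti)
    show ?thesis
    proof (cases "poly Q ?w = 0")
      case True
      then have "poly P ?w \<noteq> 0" using no_common_root by blast
      then show ?thesis unfolding rhs using True by (simp add: z \<phi>_Some)
    next
      case False
      then show ?thesis unfolding rhs using x by (auto simp: z \<phi>_Some)
    qed
  qed
  ultimately show ?thesis by (simp add: anti_Aut_iff)
qed

section \<open>The fixed points zero and infinity\<close>

text \<open>
  Conjugation by an antiholomorphic map that fixes zero turns the multiplier at zero into its complex
  conjugate, so the multiplier of the map would be real. The proof avoids derivatives: near zero the
  map is \<open>z g(z)\<close> with \<open>g\<close> continuous and \<open>g 0\<close> the multiplier, and the antiholomorphic map is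
  \<open>cnj z * h z\<close> with \<open>h\<close> continuous and \<open>h 0 \<noteq> 0\<close>. That the two commute then reads
  \<open>h z * g (cnj z * h z) = cnj (g z) * h (z * g z)\<close>, and \<open>z\<close> tends to zero.
\<close>

lemma anti_Aut_moves_0:
  assumes "A \<in> anti_Aut \<phi>"
  shows "A (Some 0) \<noteq> Some 0"
proof
  assume A0: "A (Some 0) = Some 0"
  obtain a b c d where A: "A = moebius a b c d \<circ> sphere_cnj" and det: "a * d - b * c = 1"
    using assms by (auto simp: anti_Aut_iff anti_moebius_def elim: PSL2C_cases)
  have d: "d \<noteq> 0" and b: "b = 0"
    using A0 by (auto simp: A moebius_def split: if_splits)
  then have a: "a \<noteq> 0" using det by auto
  define g where "g z = poly P (z ^ n) / poly Q (z ^ n)" for z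
  define h where "h z = a / (c * cnj z + d)" for z
  have Q00: "poly Q (0 ^ n) \<noteq> 0" using n_pos Pr by (simp add: zero_power poly_0_coeff_0 Q0)
  have cont_g: "isCont g 0" unfolding g_def using Q00 by (intro continuous_intros) auto
  have cont_h: "isCont h 0" unfolding h_def using d by (intro continuous_intros) auto
  have g0: "g 0 = coeff P 0 / cnj (coeff P r)"
    using n_pos by (simp add: g_def zero_power poly_0_coeff_0 Q0)
  have h0: "h 0 \<noteq> 0" using a d by (simp add: h_def)
  have A_Some: "A (Some z) = (if c * cnj z + d = 0 then None else Some (cnj z * h z))" for z
    using b by (simp add: A moebius_def h_def)
  have \<phi>_g: "\<phi> (Some z) = (if poly Q (z ^ n) = 0 then None else Some (z * g z))" for z
    by (simp add: \<phi>_Some g_def)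
  have lim: "((\<lambda>z. z * g z) \<longlongrightarrow> 0) (at 0)" "((\<lambda>z. cnj z * h z) \<longlongrightarrow> 0) (at 0)"
    using tendsto_mult[OF tendsto_ident_at cont_g[unfolded isCont_def]]
      tendsto_mult[OF tendsto_cnj[OF tendsto_ident_at] cont_h[unfolded isCont_def]] by simp_all
  have lim_g: "((\<lambda>z. g (cnj z * h z)) \<longlongrightarrow> g 0) (at 0)"
    using isCont_tendsto_compose[OF cont_g lim(2)] .
  have lim_h: "((\<lambda>z. h (z * g z)) \<longlongrightarrow> h 0) (at 0)"
    using isCont_tendsto_compose[OF cont_h lim(1)] .
  \<comment> \<open>Close to zero all values involved are finite.\<close>
  have "\<forall>\<^sub>F z in at 0. c * cnj z + d \<noteq> 0"
  proof (rule tendsto_imp_eventually_ne)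
    show "((\<lambda>z. c * cnj z + d) \<longlongrightarrow> c * cnj 0 + d) (at 0)" by (intro tendsto_intros)
  qed (use d in simp)
  moreover have "\<forall>\<^sub>F z in at 0. poly Q (z ^ n) \<noteq> 0"
  proof (rule tendsto_imp_eventually_ne)
    show "((\<lambda>z. poly Q (z ^ n)) \<longlongrightarrow> poly Q (0 ^ n)) (at 0)" by (intro tendsto_intros)
  qed (use Q00 in simp)
  moreover have "\<forall>\<^sub>F z in at 0. poly Q ((cnj z * h z) ^ n) \<noteq> 0"
  proof (rule tendsto_imp_eventually_ne)
    show "((\<lambda>z. poly Q ((cnj z * h z) ^ n)) \<longlongrightarrow> poly Q (0 ^ n)) (at 0)"
      by (intro tendsto_intros lim)
  qed (use Q00 in simp)
  moreover have "\<forall>\<^sub>F z in at 0. c * cnj (z * g z) + d \<noteq> 0"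
  proof (rule tendsto_imp_eventually_ne)
    show "((\<lambda>z. c * cnj (z * g z) + d) \<longlongrightarrow> c * cnj 0 + d) (at 0)"
      by (intro tendsto_intros lim)
  qed (use d in simp)
  moreover have "\<forall>\<^sub>F z in at 0. z \<noteq> (0::complex)"
    by (simp add: eventually_at_filter)
  ultimately have "\<forall>\<^sub>F z in at 0. h z * g (cnj z * h z) = cnj (g z) * h (z * g z)"
  proof eventually_elim
    case (elim z)
    have "A (\<phi> (Some z)) = \<phi> (A (Some z))" using assms by (simp add: anti_Aut_iff)
    then have "cnj z * cnj (g z) * h (z * g z) = cnj z * h z * g (cnj z * h z)"
      using elim by (simp add: \<phi>_g A_Some)
    then show ?case using elim by simp
  qed
  moreover have "((\<lambda>z. h z * g (cnj z * h z)) \<longlongrightarrow> h 0 * g 0) (at 0)"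
    using cont_h lim_g by (intro tendsto_intros) (auto simp: isCont_def)
  moreover have "((\<lambda>z. cnj (g z) * h (z * g z)) \<longlongrightarrow> cnj (g 0) * h 0) (at 0)"
    using cont_g lim_h by (intro tendsto_intros) (auto simp: isCont_def)
  ultimately have "h 0 * g 0 = cnj (g 0) * h 0"
    using LIM_unique tendsto_cong by fast
  then have "g 0 \<in> \<real>" using h0 by (simp add: Reals_cnj_iff)
  moreover have "coeff P 0 * coeff P r = g 0 * of_real ((cmod (coeff P r))\<^sup>2)"
    unfolding complex_norm_square using Pr by (simp add: g0)
  ultimately show False using nonreal by (metis Reals_mult Reals_of_real)
qed

text \<open>
  Composition with the antipode would give an antiholomorphic automorphism that fixes zero.
\<close>

lemma Aut_no_0_to_infinity:
  assumes "S \<in> Aut \<phi>"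
  shows "S (Some 0) \<noteq> None"
proof
  assume "S (Some 0) = None"
  moreover have "antipode \<circ> S \<in> anti_Aut \<phi>"
    using antipode_in_anti_Aut assms by (rule anti_Aut_comp_Aut)
  ultimately show False using anti_Aut_moves_0 by force
qed

lemma fixed_iff: "\<phi> (Some z) = Some z \<longleftrightarrow> z = 0 \<or> poly (P - Q) (z ^ n) = 0"
proof (cases "poly Q (z ^ n) = 0")
  case True
  moreover have "poly P (z ^ n) \<noteq> 0" using True no_common_root by blast
  moreover have "z \<noteq> 0" using True n_pos Pr by (auto simp: zero_power poly_0_coeff_0 Q0)
  ultimately show ?thesis by (simp add: \<phi>_Some)
qed (auto simp: \<phi>_Some field_simps)

text \<open>
  The extreme coefficients of \<open>P - Q\<close> do not vanish since the multipliers at zero and infinity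
  are not \<open>1\<close>. So the map has only finitely many fixed points, and at least one besides zero and
  infinity.
\<close>

lemma fixed_polynomial:
  shows "poly ((P - Q) \<circ>\<^sub>p monom 1 n) 0 \<noteq> 0" and "degree ((P - Q) \<circ>\<^sub>p monom 1 n) > 0"
proof -
  have *: "coeff P 0 \<noteq> cnj (coeff P r)"
    using nonreal by (metis Reals_of_real complex_norm_square mult.commute)
  then show "poly ((P - Q) \<circ>\<^sub>p monom 1 n) 0 \<noteq> 0"
    using n_pos by (simp add: poly_pcompose poly_monom zero_power poly_0_coeff_0 Q0)
  have "coeff (P - Q) r \<noteq> 0"
    using * by (auto simp: Qr)
  then have "degree (P - Q) \<ge> r" by (rule le_degree)
  then show "degree ((P - Q) \<circ>\<^sub>p monom 1 n) > 0"
    using r_pos n_pos by (simp add: degree_pcompose degree_monom_eq)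
qed

lemma finite_fixed: "finite {z. \<phi> (Some z) = Some z}"
proof -
  have "(P - Q) \<circ>\<^sub>p monom 1 n \<noteq> 0" using fixed_polynomial(1) by (metis poly_0)
  then have "finite {z. poly ((P - Q) \<circ>\<^sub>p monom 1 n) z = 0}" by (rule poly_roots_finite)
  moreover have "{z. \<phi> (Some z) = Some z} = insert 0 {z. poly ((P - Q) \<circ>\<^sub>p monom 1 n) z = 0}"
    by (auto simp: fixed_iff poly_pcompose poly_monom)
  ultimately show ?thesis by simp
qed

lemma finite_Aut_\<phi>: "finite (Aut \<phi>)"
proof (rule finite_Aut)
  have "{z. \<phi> z = z} = insert None (Some ` {z. \<phi> (Some z) = Some z})"
  proof (rule Set.set_eqI)
    fix x show "x \<in> {z. \<phi> z = z} \<longleftrightarrow> x \<in> insert None (Some ` {z. \<phi> (Some z) = Some z})"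
      by (cases x) auto
  qed
  then show fin: "finite {z. \<phi> z = z}" using finite_fixed by simp
  obtain z where z: "poly ((P - Q) \<circ>\<^sub>p monom 1 n) z = 0"
    using fundamental_theorem_of_algebra fixed_polynomial(2) by (metis constant_degree less_irrefl)
  then have "z \<noteq> 0" using fixed_polynomial(1) by auto
  then have "card {None, Some 0, Some z} = 3" by simp
  moreover have "card {None, Some 0, Some z} \<le> card {z. \<phi> z = z}"
  proof (rule card_mono[OF fin])
    show "{None, Some 0, Some z} \<subseteq> {z. \<phi> z = z}"
      using z by (simp add: fixed_iff poly_pcompose poly_monom)
  qed
  ultimately show "card {z. \<phi> z = z} \<ge> 3" by linarith
qed

lemma dilation_in_Aut:
  assumes "c ^ n = 1"
  shows "dilation c \<in> Aut \<phi>"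
proof -
  have "c \<noteq> 0" using assms n_pos by (auto simp: zero_power)
  moreover have "dilation c (\<phi> z) = \<phi> (dilation c z)" for z
    using assms by (cases z) (simp_all add: \<phi>_Some power_mult_distrib)
  ultimately show ?thesis by (simp add: Aut_iff dilation_in_PSL2C)
qed

text \<open>
  The finite fixed points form a finite set that is invariant under multiplication by the \<open>n\<close>-th
  roots of unity, so their barycentre is zero. An automorphism that fixes infinity is an affine map
  that permutes these points, and affine maps preserve barycentres.
\<close>

lemma Aut_fix_infinity_imp_fix_0:
  assumes S: "S \<in> Aut \<phi>" and inf: "S None = None"
  shows "S (Some 0) = Some 0"
proof -
  obtain a b c d where Sm: "S = moebius a b c d" and det: "a * d - b * c = 1"
    using S by (auto simp: Aut_iff elim: PSL2C_cases)
  have c: "c = 0" using inf by (auto simp: Sm moebius_def split: if_splits)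
  then have ad: "a \<noteq> 0" "d \<noteq> 0" using det by auto
  define \<alpha> \<beta> where "\<alpha> = a / d" and "\<beta> = b / d"
  have \<alpha>: "\<alpha> \<noteq> 0" using ad by (simp add: \<alpha>_def)
  have S_Some: "S (Some z) = Some (\<alpha> * z + \<beta>)" for z
    using c ad by (simp add: Sm moebius_def \<alpha>_def \<beta>_def add_divide_distrib)
  define B where "B = {z. \<phi> (Some z) = Some z}"
  have finB: "finite B" unfolding B_def by (rule finite_fixed)
  have "0 \<in> B" by (simp add: B_def)
  then have cardB: "card B \<noteq> 0" using finB by auto
  have affine: "\<Sum>B = x * \<Sum>B + of_nat (card B) * y"
    if R: "R \<in> Aut \<phi>" "\<And>z. R (Some z) = Some (x * z + y)" "x \<noteq> 0" for R x y
  proof -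
    have "(\<lambda>z. x * z + y) ` B \<subseteq> B"
    proof (intro image_subsetI)
      fix z assume "z \<in> B"
      then have "R (\<phi> (Some z)) = Some (x * z + y)" using R(2) by (simp add: B_def)
      moreover have "R (\<phi> (Some z)) = \<phi> (R (Some z))" using R(1) by (simp add: Aut_iff)
      ultimately show "x * z + y \<in> B" using R(2) by (simp add: B_def)
    qed
    moreover have inj: "inj_on (\<lambda>z. x * z + y) B" using R(3) by (auto simp: inj_on_def)
    ultimately have "(\<lambda>z. x * z + y) ` B = B" using finB by (simp add: endo_inj_surj)
    then have "\<Sum>B = (\<Sum>z\<in>B. x * z + y)" using sum.reindex[OF inj, of "\<lambda>z. z"] by (simp add: comp_def)
    also have "\<dots> = x * \<Sum>B + of_nat (card B) * y" by (simp add: sum.distrib sum_distrib_left)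
    finally show ?thesis .
  qed
  have "\<not> {c :: complex. c ^ n = 1} \<subseteq> {1}"
  proof
    assume "{c :: complex. c ^ n = 1} \<subseteq> {1}"
    then have "card {c :: complex. c ^ n = 1} \<le> card {1 :: complex}" by (intro card_mono) auto
    then show False using card_roots_unity_eq[OF n_pos] n4 by simp
  qed
  then obtain \<omega> :: complex where w: "\<omega> ^ n = 1" "\<omega> \<noteq> 1" by blast
  then have "\<omega> \<noteq> 0" using n_pos by (auto simp: zero_power)
  then have "\<Sum>B = \<omega> * \<Sum>B"
    using affine[of "dilation \<omega>" \<omega> 0] dilation_in_Aut[OF w(1)] by simp
  then have "\<Sum>B = 0" using w(2) by simp
  then have "\<beta> = 0" using affine[OF S S_Some \<alpha>] cardB by simp
  then show ?thesis by (simp add: S_Some)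
qed

text \<open>
  Conjugation by the antipode interchanges the roles of zero and infinity.
\<close>

lemma Aut_fix_0_imp_fix_infinity:
  assumes S: "S \<in> Aut \<phi>" and zero: "S (Some 0) = Some 0"
  shows "S None = None"
proof -
  let ?R = "antipode \<circ> (S \<circ> antipode)"
  have "?R \<in> Aut \<phi>"
    using S antipode_in_anti_Aut by (intro anti_Aut_comp Aut_comp_anti_Aut)
  moreover have "?R None = None" using zero by simp
  ultimately have "?R (Some 0) = Some 0" by (rule Aut_fix_infinity_imp_fix_0)
  then have "antipode (S None) = antipode None" by simp
  moreover have "inj antipode"
    using antipode_in_anti_Aut anti_moebius_bij by (auto simp: anti_Aut_iff bij_is_inj)
  ultimately show ?thesis by (simp only: inj_eq)
qed

text \<open>
  An automorphism that fixes zero and infinity is \<open>z \<mapsto> c z\<close>, and then \<open>\<psi>(e w) = \<psi>(w)\<close> for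
  \<open>e = c\<^sup>n\<close>. As \<open>P\<close> and \<open>Q\<close> are coprime, \<open>P(e w)\<close> is a constant multiple of \<open>P(w)\<close>; the constant term
  shows that the multiple is \<open>1\<close>, and the linear term shows that \<open>e = 1\<close>.
\<close>

lemma Aut_fix_0_imp_dilation:
  assumes S: "S \<in> Aut \<phi>" and zero: "S (Some 0) = Some 0"
  obtains c where "c ^ n = 1" "S = dilation c"
proof -
  have inf: "S None = None" using assms by (rule Aut_fix_0_imp_fix_infinity)
  obtain a b c' d where Sm: "S = moebius a b c' d" and det: "a * d - b * c' = 1"
    using S by (auto simp: Aut_iff elim: PSL2C_cases)
  have c': "c' = 0" using inf by (auto simp: Sm moebius_def split: if_splits)
  have ad: "a \<noteq> 0" "d \<noteq> 0" using det c' by auto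
  have b: "b = 0" using zero c' ad by (auto simp: Sm moebius_def)
  define c where "c = a / d"
  have S_dil: "S = dilation c"
    using b c' ad by (auto simp: Sm moebius_def c_def fun_eq_iff dilation_def split: option.split)
  have c0: "c \<noteq> 0" using ad by (simp add: c_def)
  define e where "e = c ^ n"
  have e0: "e \<noteq> 0" using c0 by (simp add: e_def)
  let ?P' = "P \<circ>\<^sub>p [:0, e:]" and ?Q' = "Q \<circ>\<^sub>p [:0, e:]"
  have "?P' * Q = P * ?Q'"
  proof -
    have "poly (?P' * Q) w = poly (P * ?Q') w" for w
    proof -
      obtain z where z: "z ^ n = w"
        using nth_root_exists[OF n_pos] by blast
      have "dilation c (\<phi> (Some z)) = \<phi> (dilation c (Some z))"
        using S by (simp add: S_dil Aut_iff)
      then have "poly ?P' w * poly Q w = poly P w * poly ?Q' w \<or> z = 0"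
        using c0 by (auto simp: \<phi>_Some power_mult_distrib z e_def poly_pcompose mult.commute
          field_simps split: if_splits)
      then show ?thesis using z n_pos by (auto simp: poly_pcompose zero_power)
    qed
    then show ?thesis by (auto simp: poly_eq_poly_eq_iff[symmetric] fun_eq_iff simp del: poly_mult)
  qed
  then have "P dvd ?P' * Q" by simp
  then have "P dvd ?P'" using cop by (simp add: coprime_dvd_mult_left_iff)
  then obtain s where s: "?P' = P * s" ..
  have "degree ?P' = r" using e0 by (simp add: degree_pcompose degree_eq)
  moreover have "P \<noteq> 0" using P0 by auto
  moreover from this have "s \<noteq> 0" using s \<open>degree ?P' = r\<close> r_pos by auto
  ultimately have "degree s = 0" using s degree_mult_eq[of P s] degree_eq by simp
  then obtain t where t: "s = [:t:]" by (rule degree_eq_zeroE)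
  have coeffs: "coeff P k * e ^ k = t * coeff P k" for k
    using arg_cong[OF s, of "\<lambda>p. coeff p k"] by (simp add: t coeff_pcompose_linear)
  have "t = 1" using coeffs[of 0] P0 by simp
  then have "e = 1" using coeffs[of 1] linear by simp
  then show ?thesis using that S_dil by (simp add: e_def)
qed

section \<open>Automorphisms and antiholomorphic automorphisms\<close>

text \<open>
  Zero and infinity have the same stabilizer, of order \<open>n \<ge> 4\<close>, and lie in different orbits, so the
  count of fixed points shows that every automorphism fixes them.
\<close>

lemma Aut_\<phi>: "Aut \<phi> = dilation ` {c. c ^ n = 1}"
proof -
  let ?G = "PSL2C\<lparr>carrier := Aut \<phi>\<rparr>" and ?D = "dilation ` {c. c ^ n = 1}"
  interpret act: group_action ?G UNIV "\<lambda>S. S" by (rule group_action_Aut)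
  have stab0: "stabilizer ?G (\<lambda>S. S) (Some 0) = ?D"
    by (auto simp: stabilizer_def dilation_in_Aut elim: Aut_fix_0_imp_dilation)
  have stab_inf: "stabilizer ?G (\<lambda>S. S) None = stabilizer ?G (\<lambda>S. S) (Some 0)"
    using Aut_fix_0_imp_fix_infinity Aut_fix_infinity_imp_fix_0 by (auto simp: stabilizer_def)
  have "card ?D = n"
    using card_roots_unity_eq[OF n_pos] inj_on_subset[OF inj_dilation] by (simp add: card_image)
  have "stabilizer ?G (\<lambda>S. S) (Some 0) = carrier ?G"
  proof (rule act.stabilizer_eq_carrier_if_few_fixed_points[where y = None])
    show "None \<notin> orbit ?G (\<lambda>S. S) (Some 0)"
      using Aut_no_0_to_infinity by (force simp: orbit_def)
    fix S assume "S \<in> carrier ?G" "S \<noteq> \<one>\<^bsub>?G\<^esub>"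
    then show "finite (invariants UNIV (\<lambda>S. S) S) \<and> invariants UNIV (\<lambda>S. S) S \<noteq> {} \<and>
        card (invariants UNIV (\<lambda>S. S) S) \<le> 2"
      using PSL2C_fixed_points[of S] by (simp add: invariants_def Aut_iff)
  qed (use finite_Aut_\<phi> stab0 stab_inf \<open>card ?D = n\<close> n4 in auto)
  then show ?thesis using stab0 by simp
qed

text \<open>
  Up to a dilation by a root of unity the antipode is the only antiholomorphic automorphism, so each
  of them is \<open>z \<mapsto> u / cnj z\<close> with \<open>u\<^sup>n = -1\<close>. A fixed point \<open>z\<close> would give \<open>u = z * cnj z\<close>, whose powers
  are not negative.
\<close>

lemma anti_Aut_no_fixed_point:
  assumes B: "B \<in> anti_Aut \<phi>"
  shows "B x \<noteq> x"
proof
  assume fixed: "B x = x"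
  have "B \<circ> antipode \<in> Aut \<phi>"
    using B antipode_in_anti_Aut by (rule anti_Aut_comp)
  then obtain c where c: "c ^ n = 1" "B \<circ> antipode = dilation c"
    by (auto simp: Aut_\<phi>)
  then have Bc: "B (antipode y) = dilation c y" for y by (simp add: fun_eq_iff)
  show False
  proof (cases "x = None \<or> x = Some 0")
    case True
    then show False using fixed Bc[of None] Bc[of "Some 0"] by auto
  next
    case False
    then obtain z where x: "x = Some z" and z: "z \<noteq> 0" by (cases x) auto
    let ?u = "cnj (\<zeta> / z)"
    have "antipode (Some ?u) = x" using z \<zeta>_nz by (simp add: x)
    then have "c * ?u = z" using Bc[of "Some ?u"] fixed x by simp
    then have "c * cnj \<zeta> = z * cnj z" using z by (simp add: field_simps)
    then have "(c * cnj \<zeta>) ^ n = of_real ((cmod z)\<^sup>2) ^ n"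
      by (simp only: complex_norm_square)
    moreover have "(c * cnj \<zeta>) ^ n = -1"
      using c(1) \<zeta>_power by (metis complex_cnj_minus complex_cnj_one complex_cnj_power mult_1 power_mult_distrib)
    ultimately have "complex_of_real (((cmod z)\<^sup>2) ^ n) = of_real (-1)" by simp
    then have "((cmod z)\<^sup>2) ^ n = -1" by (simp only: of_real_eq_iff)
    moreover have "((cmod z)\<^sup>2) ^ n \<ge> 0" by simp
    ultimately show False by linarith
  qed
qed

lemma pseudo_real_\<phi>: "pseudo_real \<phi>"
  unfolding pseudo_real_def reflection_def
  using rational_map_\<phi> antipode_in_anti_Aut anti_Aut_no_fixed_point by blast

end

theorem theorem8:
  fixes n r :: nat and a :: "nat \<Rightarrow> complex"
    and \<psi> \<phi> T :: "sphere \<Rightarrow> sphere"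
  assumes "n \<ge> 4" and "r \<ge> 2" and "even r"
    and "a 1 * a r \<noteq> 0" and "a 0 * a r \<notin> \<real>"
    and "rational_map_of_degree r \<psi>"
    and "\<And>z. (\<Sum>k\<le>r. (-1) ^ k * cnj (a (r - k)) * z ^ k) \<noteq> 0 \<Longrightarrow>
           \<psi> (Some z) = Some ((\<Sum>k\<le>r. a k * z ^ k) / (\<Sum>k\<le>r. (-1) ^ k * cnj (a (r - k)) * z ^ k))"
    and "\<And>z. \<phi> z = sphere_times z (\<psi> (map_option (\<lambda>w. w ^ n) z))"
    and "\<And>z. T z = map_option (\<lambda>w. exp (2 * of_real pi * \<i> / of_nat n) * w) z"
  shows "pseudo_real \<phi> \<and>
         Aut \<phi> = generate PSL2C {T} \<and>
         PSL2C\<lparr>carrier := Aut \<phi>\<rparr> \<cong> integer_mod_group n"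
proof -
  define P where "P = (\<Sum>k\<le>r. monom (a k) k)"
  define Q where "Q = (\<Sum>k\<le>r. monom ((-1) ^ k * cnj (a (r - k))) k)"
  have poly_P: "poly P z = (\<Sum>k\<le>r. a k * z ^ k)" for z
    by (simp add: P_def poly_sum poly_monom)
  have poly_Q: "poly Q z = (\<Sum>k\<le>r. (-1) ^ k * cnj (a (r - k)) * z ^ k)" for z
    by (simp add: Q_def poly_sum poly_monom)
  have coeff_P: "coeff P k = a k" and coeff_Q: "coeff Q k = (-1) ^ k * cnj (a (r - k))" if "k \<le> r" for k
    using that by (simp_all add: P_def Q_def coeff_sum)
  have deg: "degree P \<le> r" "degree Q \<le> r"
    unfolding P_def Q_def
    by (intro degree_sum_le; force intro: order_trans[OF degree_monom_le])+
  have a0: "a 0 \<noteq> 0" using assms(5) by auto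
  then have Qr: "coeff Q r \<noteq> 0" by (simp add: coeff_Q)
  then have degQ: "degree Q = r" using deg(2) le_degree by (metis le_antisym)
  obtain p q where pq: "coprime p q" "max (degree p) (degree q) = r" "\<psi> = quotient_map p q"
    using assms(6) by (auto simp: rational_map_of_degree_def)
  \<comment> \<open>The formula for \<open>\<psi>\<close> and its degree show that the given fraction has no common factor.\<close>
  have "coprime P Q \<and> quotient_map p q = quotient_map P Q"
    using pq(1,2) deg(1) degQ
  proof (rule quotient_map_unique)
    show "Q \<noteq> 0" using Qr by auto
    fix z assume "poly Q z \<noteq> 0"
    then show "quotient_map p q (Some z) = Some (poly P z / poly Q z)"
      using assms(7)[of z] by (simp add: poly_P poly_Q pq(3))
  qed
  then have cop: "coprime P Q" and \<psi>: "\<psi> = quotient_map P Q" using pq(3) by auto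
  interpret ap: antipodal_pair n r P Q
    by unfold_locales
      (use assms(1-5) deg cop in \<open>auto simp: coeff_P coeff_Q\<close>)
  have "\<phi> z = spun_map n P Q z" for z
  proof (cases z)
    case None
    have "\<psi> None = Some (coeff P r / coeff Q r)"
      using Qr by (simp add: \<psi> quotient_map_def ap.degree_eq)
    moreover have "coeff P r / coeff Q r \<noteq> 0" using ap.Pr Qr by simp
    ultimately show ?thesis using assms(8)[of None] None by simp
  next
    case (Some w)
    show ?thesis
    proof (cases "poly Q (w ^ n) = 0")
      case True
      then have "w \<noteq> 0" using ap.n_pos ap.Pr ap.Q0 by (auto simp: zero_power poly_0_coeff_0)
      then show ?thesis using True Some assms(8)[of z] by (simp add: \<psi> quotient_map_def ap.\<phi>_Some)
    next
      case False
      then show ?thesis using Some assms(8)[of z] by (simp add: \<psi> quotient_map_def ap.\<phi>_Some)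
    qed
  qed
  then have phi: "\<phi> = spun_map n P Q" by blast
  have T: "T = dilation (exp (2 * of_real pi * \<i> / of_nat n))"
    using assms(9) by (simp add: fun_eq_iff dilation_def)
  show ?thesis
    unfolding phi T
    using ap.pseudo_real_\<phi> ap.Aut_\<phi> dilations_generated[OF ap.n_pos] dilations_iso_integer_mod_group[OF ap.n_pos]
    by simp
qed

end
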